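(* Let $\mathit{Var}$ be finite, $M$ a commutative complete quantale and $\sigma:\mathit{Var}\to M_1$. Fix a command $C$ and $W\subseteq\mathit{Var}$, and put $\mathbb J_W=\bigotimes_{w\in W}\Delta_C(w)\in\mathcal U$ and $\mathbb J^{\mathbb N}_W=\bigotimes_{w\in W}\Delta^{\mathbb N}_C(w)\in\mathcal U_{\mathbb N}$. If every $v\in\mathit{Var}$ for which some $m\in\mathbb J^{\mathbb N}_W$ has $m(v)\ge2$ satisfies $\sigma(v)\otimes\sigma(v)=\sigma(v)$, then $\alpha_\sigma(\mathbb J_W)=\alpha^{\mathbb N}_\sigma(\mathbb J^{\mathbb N}_W)$.
   Context: Quantales. A commutative complete quantale $\langle M,\sqsubseteq,\bigvee,\otimes,1\rangle$ is a complete lattice with a commutative monoid $(\otimes,1)$ such that $\otimes$ distributes over arbitrary joins. $M_1=\{m\mid 1\sqsubseteq m\}$. $m^0=1$, $m^n$ is the $n$-fold tensor power, $m^*=\bigvee_{n\ge0}m^n$. Empty tensors are $1$. Universal objects. $\mathcal U_{\mathbb N}$ is the set of downsets of $(\mathbb N^{\mathit{Var}},\le)$ ordered by inclusion, with $\bigvee=\bigcup$, $\mathbb M\otimes\mathbb N={\downarrow}\{m+n\mid m\in\mathbb M,n\in\mathbb N\}$, $1={\downarrow}0$, generators $\hat v={\downarrow}e_v$. $\mathcal U$ is the set of downsets of $(\mathcal P(\mathit{Var}),\subseteq)$ ordered by inclusion, with $\bigvee=\bigcup$, $\mathbb X\otimes\mathbb Y={\downarrow}\{X\cup Y\mid X\in\mathbb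 X,Y\in\mathbb Y\}$, $1={\downarrow}\emptyset$, generators $\hat v={\downarrow}\{v\}$. $\alpha^{\mathbb N}_\sigma(\mathbb M)=\bigvee_{m\in\mathbb M}\bigotimes_v\sigma(v)^{m(v)}$ and $\alpha_\sigma(\mathbb X)=\bigvee_{X\in\mathbb X}\bigotimes_{v\in X}\sigma(v)$. Language. Commands: $\mathsf{skip}$, $x:=E$, $C_1;C_2$, $\mathsf{if}\;E\;C_1\;C_2$, $\mathsf{while}\;E\;C$; $\mathit{fv}(E)$ is the set of variables of $E$, $\mathit{asgn}(C)$ the set of variables assigned in $C$. Algorithmic system. $t_E(\Gamma)=\bigotimes_{v\in\mathit{fv}(E)}\Gamma(v)$ and $\mathcal A^C_M(p,\Gamma):\mathit{Var}\to M_1$ ($p\in M_1$, $\Gamma:\mathit{Var}\to M_1$) is defined by recursion on $C$: $\Gamma$ for $\mathsf{skip}$; $\Gamma[x\mapsto p\otimes t_E(\Gamma)]$ for $x:=E$; $\mathcal A^{C_2}(p,\mathcal A^{C_1}(p,\Gamma))$ for $C_1;C_2$; for $\mathsf{if}\;E\;C_1\;C_2$, with $t=t_E(\Gamma)$, $\Gamma_i'=\mathcal A^{C_i}(p\otimes t,\Gamma)$, the environment $x\mapsto t\otimes(\Gamma_1'(x)\vee\Gamma_2'(x))$ for $x\in\mathit{asgn}(C_1)\cup\mathit{asgn}(C_2)$ and $x\mapsto\Gamma(x)$ otherwise; for $\mathsf{while}\;E\;C$, with $\Gamma^*$ the least fixed point of $\Theta\mapsto\Gamma\vee\mathcal A^C(p\otimes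 t_E(\Theta),\Theta)$ and $t=t_E(\Gamma^* )$, the environment $x\mapsto t^*\otimes\Gamma^*(x)$ for $x\in\mathit{asgn}(C)$ and $x\mapsto\Gamma^*(x)$ otherwise. $\Delta_C=\mathcal A^C_{\mathcal U}(1,v\mapsto\hat v)$ and $\Delta^{\mathbb N}_C=\mathcal A^C_{\mathcal U_{\mathbb N}}(1,v\mapsto\hat v)$. *)

theory Defs
  imports Main
begin

section \<open>Commutative complete quantales\<close>

class comm_quantale = complete_lattice + comm_monoid_mult +
  assumes mult_Sup: "x * Sup A = (SUP a\<in>A. x * a)"
begin

lemma mult_left_mono_quantale:
  assumes "a \<le> b" shows "x * a \<le> x * b"
proof -
  have "x * b = x * Sup {a, b}" using assms by (simp add: sup_absorb2)
  also have "\<dots> = sup (x * a) (x * b)" by (subst mult_Sup) simp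
  finally show ?thesis by (metis sup_ge1)
qed

lemma mult_mono_quantale: "a \<le> b \<Longrightarrow> c \<le> d \<Longrightarrow> a * c \<le> b * d"
  by (metis mult_left_mono_quantale mult.commute order_trans)

lemma power_mono_quantale: "a \<le> b \<Longrightarrow> a ^ n \<le> b ^ n"
  by (induction n) (auto intro: mult_mono_quantale)

lemma prod_mono_quantale: "(\<And>i. i \<in> S \<Longrightarrow> f i \<le> g i) \<Longrightarrow> prod f S \<le> prod g S"
  by (induction S rule: infinite_finite_induct) (auto intro: mult_mono_quantale)

lemma one_le_mult_quantale: "1 \<le> a \<Longrightarrow> 1 \<le> b \<Longrightarrow> 1 \<le> a * b"
  using mult_mono_quantale[of 1 a 1 b] by simp

lemma one_le_prod_quantale: "(\<And>i. i \<in> S \<Longrightarrow> 1 \<le> f i) \<Longrightarrow> 1 \<le> prod f S"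
  using prod_mono_quantale[of S "\<lambda>_. 1" f] by simp

definition qstar :: "'a \<Rightarrow> 'a" where
  "qstar m = (SUP n. m ^ n)"

lemma qstar_mono: "a \<le> b \<Longrightarrow> qstar a \<le> qstar b"
  unfolding qstar_def by (intro SUP_mono) (auto intro: power_mono_quantale)

lemma one_le_qstar: "1 \<le> qstar a"
  unfolding qstar_def using SUP_upper[of 0 UNIV "\<lambda>n. a ^ n"] by simp

end


section \<open>The universal quantales\<close>

definition down :: "'a::order set \<Rightarrow> 'a set" where
  "down S = {x. \<exists>y\<in>S. x \<le> y}"

lemma down_downset: "x \<in> down S \<Longrightarrow> y \<le> x \<Longrightarrow> y \<in> down S"
  unfolding down_def by (auto intro: order_trans)

text \<open>\<open>'v univN\<close> and \<open>'v univ\<close> are the sets of downsets of multiplicity vectors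
  \<open>'v \<Rightarrow> nat\<close> (ordered pointwise) and of sets of variables.\<close>

typedef 'v univN = "{D :: ('v \<Rightarrow> nat) set. \<forall>m\<in>D. \<forall>n\<le>m. n \<in> D}"
  morphisms elemsN AbsN by (rule exI[of _ "{}"]) simp

typedef 'v univ = "{D :: 'v set set. \<forall>X\<in>D. \<forall>Y\<subseteq>X. Y \<in> D}"
  morphisms elems Abs by (rule exI[of _ "{}"]) simp

lemma elemsN_downset: "m \<in> elemsN D \<Longrightarrow> n \<le> m \<Longrightarrow> n \<in> elemsN D"
  using elemsN[of D] by blast

lemma elems_downset: "X \<in> elems D \<Longrightarrow> Y \<subseteq> X \<Longrightarrow> Y \<in> elems D"
  using elems[of D] by blast

lemma elemsN_AbsN:
  "(\<And>m n. m \<in> D \<Longrightarrow> n \<le> m \<Longrightarrow> n \<in> D) \<Longrightarrow> elemsN (AbsN D) = D"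
  by (rule AbsN_inverse) blast

lemma elems_Abs:
  "(\<And>X Y. X \<in> D \<Longrightarrow> Y \<subseteq> X \<Longrightarrow> Y \<in> D) \<Longrightarrow> elems (Abs D) = D"
  by (rule Abs_inverse) blast

instantiation univN :: (type) comm_quantale
begin

definition less_eq_univN :: "'a univN \<Rightarrow> 'a univN \<Rightarrow> bool" where
  "D \<le> E \<longleftrightarrow> elemsN D \<subseteq> elemsN E"
definition less_univN :: "'a univN \<Rightarrow> 'a univN \<Rightarrow> bool" where
  "D < E \<longleftrightarrow> elemsN D \<subset> elemsN E"
definition Sup_univN :: "'a univN set \<Rightarrow> 'a univN" where
  "Sup S = AbsN (\<Union>D\<in>S. elemsN D)"
definition Inf_univN :: "'a univN set \<Rightarrow> 'a univN" where
  "Inf S = AbsN (\<Inter>D\<in>S. elemsN D)"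
definition sup_univN :: "'a univN \<Rightarrow> 'a univN \<Rightarrow> 'a univN" where
  "sup D E = AbsN (elemsN D \<union> elemsN E)"
definition inf_univN :: "'a univN \<Rightarrow> 'a univN \<Rightarrow> 'a univN" where
  "inf D E = AbsN (elemsN D \<inter> elemsN E)"
definition bot_univN :: "'a univN" where
  "bot = AbsN {}"
definition top_univN :: "'a univN" where
  "top = AbsN UNIV"
definition one_univN :: "'a univN" where
  "1 = AbsN (down {\<lambda>_. 0})"
definition times_univN :: "'a univN \<Rightarrow> 'a univN \<Rightarrow> 'a univN" where
  "D * E = AbsN (down {\<lambda>v. m v + n v | m n. m \<in> elemsN D \<and> n \<in> elemsN E})"

lemma elemsN_Sup: "elemsN (Sup S) = (\<Union>D\<in>S. elemsN D)"
  unfolding Sup_univN_def by (rule elemsN_AbsN) (auto intro: elemsN_downset)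
lemma elemsN_Inf: "elemsN (Inf S) = (\<Inter>D\<in>S. elemsN D)"
  unfolding Inf_univN_def by (rule elemsN_AbsN) (auto intro: elemsN_downset)
lemma elemsN_sup: "elemsN (sup D E) = elemsN D \<union> elemsN E"
  unfolding sup_univN_def by (rule elemsN_AbsN) (auto intro: elemsN_downset)
lemma elemsN_inf: "elemsN (inf D E) = elemsN D \<inter> elemsN E"
  unfolding inf_univN_def by (rule elemsN_AbsN) (auto intro: elemsN_downset)
lemma elemsN_bot: "elemsN bot = {}"
  unfolding bot_univN_def by (rule elemsN_AbsN) auto
lemma elemsN_top: "elemsN top = UNIV"
  unfolding top_univN_def by (rule elemsN_AbsN) auto
lemma elemsN_one: "elemsN 1 = {\<lambda>_. 0}"
proof -
  have "elemsN 1 = down {\<lambda>_. 0 :: nat}"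
    unfolding one_univN_def by (rule elemsN_AbsN) (rule down_downset)
  then show ?thesis by (auto simp: down_def le_fun_def)
qed
lemma elemsN_times:
  "elemsN (D * E) = {\<lambda>v. m v + n v | m n. m \<in> elemsN D \<and> n \<in> elemsN E}" (is "_ = ?S")
proof -
  have "elemsN (D * E) = down ?S"
    unfolding times_univN_def by (rule elemsN_AbsN) (rule down_downset)
  moreover have "down ?S \<subseteq> ?S"
  proof
    fix k assume "k \<in> down ?S"
    then obtain m n where mn: "m \<in> elemsN D" "n \<in> elemsN E" and k: "k \<le> (\<lambda>v. m v + n v)"
      by (auto simp: down_def)
    let ?a = "\<lambda>v. min (k v) (m v)" and ?b = "\<lambda>v. k v - min (k v) (m v)"
    have "?a \<in> elemsN D" by (rule elemsN_downset[OF mn(1)]) (simp add: le_fun_def)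
    moreover have "?b \<in> elemsN E"
    proof (rule elemsN_downset[OF mn(2)], rule le_funI)
      fix v
      show "k v - min (k v) (m v) \<le> n v" using le_funD[OF k, of v] by linarith
    qed
    moreover have "k = (\<lambda>v. ?a v + ?b v)" by auto
    ultimately show "k \<in> ?S"
      by (intro CollectI exI[of _ ?a] exI[of _ ?b] conjI)
  qed
  moreover have "?S \<subseteq> down ?S" unfolding down_def by blast
  ultimately show ?thesis by blast
qed

instance
proof
  fix D E F :: "'a univN"
  show "D * E * F = D * (E * F)"
  proof (rule elemsN_inject[THEN iffD1], rule set_eqI)
    fix k
    have "k \<in> elemsN (D * E * F) \<longleftrightarrow> (\<exists>m\<in>elemsN D. \<exists>n\<in>elemsN E. \<exists>l\<in>elemsN F. k = (\<lambda>v. m v + n v + l v))"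
      unfolding elemsN_times by fastforce
    also have "\<dots> \<longleftrightarrow> k \<in> elemsN (D * (E * F))"
      unfolding elemsN_times add.assoc by fastforce
    finally show "k \<in> elemsN (D * E * F) \<longleftrightarrow> k \<in> elemsN (D * (E * F))" .
  qed
  show "D * E = E * D"
    by (rule elemsN_inject[THEN iffD1], unfold elemsN_times)
      (subst add.commute, blast)
  show "1 * D = D"
    by (rule elemsN_inject[THEN iffD1]) (auto simp: elemsN_times elemsN_one)
next
  fix D :: "'a univN" and S
  show "D * Sup S = (SUP E\<in>S. D * E)"
    by (rule elemsN_inject[THEN iffD1], unfold elemsN_Sup image_image UN_simps elemsN_times) blast
qed (auto simp: less_eq_univN_def less_univN_def elemsN_Sup elemsN_Inf elemsN_sup elemsN_inf
      elemsN_bot elemsN_top elemsN_inject[symmetric])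

end

instantiation univ :: (type) comm_quantale
begin

definition less_eq_univ :: "'a univ \<Rightarrow> 'a univ \<Rightarrow> bool" where
  "D \<le> E \<longleftrightarrow> elems D \<subseteq> elems E"
definition less_univ :: "'a univ \<Rightarrow> 'a univ \<Rightarrow> bool" where
  "D < E \<longleftrightarrow> elems D \<subset> elems E"
definition Sup_univ :: "'a univ set \<Rightarrow> 'a univ" where
  "Sup S = Abs (\<Union>D\<in>S. elems D)"
definition Inf_univ :: "'a univ set \<Rightarrow> 'a univ" where
  "Inf S = Abs (\<Inter>D\<in>S. elems D)"
definition sup_univ :: "'a univ \<Rightarrow> 'a univ \<Rightarrow> 'a univ" where
  "sup D E = Abs (elems D \<union> elems E)"
definition inf_univ :: "'a univ \<Rightarrow> 'a univ \<Rightarrow> 'a univ" where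
  "inf D E = Abs (elems D \<inter> elems E)"
definition bot_univ :: "'a univ" where
  "bot = Abs {}"
definition top_univ :: "'a univ" where
  "top = Abs UNIV"
definition one_univ :: "'a univ" where
  "1 = Abs (down {{}})"
definition times_univ :: "'a univ \<Rightarrow> 'a univ \<Rightarrow> 'a univ" where
  "D * E = Abs (down {X \<union> Y | X Y. X \<in> elems D \<and> Y \<in> elems E})"

lemma elems_Sup: "elems (Sup S) = (\<Union>D\<in>S. elems D)"
  unfolding Sup_univ_def by (rule elems_Abs) (auto intro: elems_downset)
lemma elems_Inf: "elems (Inf S) = (\<Inter>D\<in>S. elems D)"
  unfolding Inf_univ_def by (rule elems_Abs) (auto intro: elems_downset)
lemma elems_sup: "elems (sup D E) = elems D \<union> elems E"
  unfolding sup_univ_def by (rule elems_Abs) (auto intro: elems_downset)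
lemma elems_inf: "elems (inf D E) = elems D \<inter> elems E"
  unfolding inf_univ_def by (rule elems_Abs) (auto intro: elems_downset)
lemma elems_bot: "elems bot = {}"
  unfolding bot_univ_def by (rule elems_Abs) auto
lemma elems_top: "elems top = UNIV"
  unfolding top_univ_def by (rule elems_Abs) auto
lemma elems_one: "elems 1 = {{}}"
proof -
  have "elems 1 = down {{}}"
    unfolding one_univ_def by (rule elems_Abs) (rule down_downset)
  then show ?thesis by (auto simp: down_def)
qed
lemma elems_times:
  "elems (D * E) = {X \<union> Y | X Y. X \<in> elems D \<and> Y \<in> elems E}" (is "_ = ?S")
proof -
  have "elems (D * E) = down ?S"
    unfolding times_univ_def by (rule elems_Abs) (rule down_downset)
  moreover have "down ?S \<subseteq> ?S"
  proof
    fix Z assume "Z \<in> down ?S"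
    then obtain X Y where XY: "X \<in> elems D" "Y \<in> elems E" and Z: "Z \<subseteq> X \<union> Y"
      by (auto simp: down_def)
    have "Z \<inter> X \<in> elems D" "Z \<inter> Y \<in> elems E"
      using XY by (auto intro: elems_downset)
    moreover have "Z = (Z \<inter> X) \<union> (Z \<inter> Y)" using Z by blast
    ultimately show "Z \<in> ?S" by blast
  qed
  moreover have "?S \<subseteq> down ?S" unfolding down_def by blast
  ultimately show ?thesis by blast
qed

instance
proof
  fix D E F :: "'a univ"
  show "D * E * F = D * (E * F)"
  proof (rule elems_inject[THEN iffD1], rule set_eqI)
    fix Z
    have "Z \<in> elems (D * E * F) \<longleftrightarrow> (\<exists>X\<in>elems D. \<exists>Y\<in>elems E. \<exists>Y'\<in>elems F. Z = X \<union> Y \<union> Y')"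
      unfolding elems_times by blast
    also have "\<dots> \<longleftrightarrow> Z \<in> elems (D * (E * F))"
      unfolding elems_times Un_assoc by blast
    finally show "Z \<in> elems (D * E * F) \<longleftrightarrow> Z \<in> elems (D * (E * F))" .
  qed
  show "D * E = E * D"
    by (rule elems_inject[THEN iffD1], unfold elems_times)
      (subst Un_commute, blast)
  show "1 * D = D"
    by (rule elems_inject[THEN iffD1]) (auto simp: elems_times elems_one)
next
  fix D :: "'a univ" and S
  show "D * Sup S = (SUP E\<in>S. D * E)"
    by (rule elems_inject[THEN iffD1], unfold elems_Sup image_image UN_simps elems_times) blast
qed (auto simp: less_eq_univ_def less_univ_def elems_Sup elems_Inf elems_sup elems_inf
      elems_bot elems_top elems_inject[symmetric])

end

definition genN :: "'v \<Rightarrow> 'v univN" where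
  "genN v = AbsN (down {\<lambda>u. if u = v then 1 else 0})"

definition gen :: "'v \<Rightarrow> 'v univ" where
  "gen v = Abs (down {{v}})"

lemma elemsN_genN: "elemsN (genN v) = down {\<lambda>u. if u = v then 1 else 0}"
  unfolding genN_def by (rule elemsN_AbsN) (rule down_downset)

lemma elems_gen: "elems (gen v) = down {{v}}"
  unfolding gen_def by (rule elems_Abs) (rule down_downset)

definition alphaN :: "('v::finite \<Rightarrow> 'm::comm_quantale) \<Rightarrow> 'v univN \<Rightarrow> 'm" where
  "alphaN \<sigma> D = (SUP m\<in>elemsN D. \<Prod>v\<in>UNIV. \<sigma> v ^ m v)"

definition alpha :: "('v::finite \<Rightarrow> 'm::comm_quantale) \<Rightarrow> 'v univ \<Rightarrow> 'm" where
  "alpha \<sigma> D = (SUP X\<in>elems D. \<Prod>v\<in>X. \<sigma> v)"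


section \<open>The language and the algorithmic system\<close>

text \<open>Expressions are an arbitrary type \<open>'e\<close>; only their variables matter, which are
  supplied by a function \<open>fv\<close> passed as a parameter below.\<close>

datatype ('v, 'e) com =
    Skip
  | Assign 'v 'e
  | Seq "('v, 'e) com" "('v, 'e) com"
  | If 'e "('v, 'e) com" "('v, 'e) com"
  | While 'e "('v, 'e) com"

primrec asgn :: "('v, 'e) com \<Rightarrow> 'v set" where
  "asgn Skip = {}"
| "asgn (Assign x E) = {x}"
| "asgn (Seq C1 C2) = asgn C1 \<union> asgn C2"
| "asgn (If E C1 C2) = asgn C1 \<union> asgn C2"
| "asgn (While E C) = asgn C"

definition texp :: "('e \<Rightarrow> 'v::finite set) \<Rightarrow> 'e \<Rightarrow> ('v \<Rightarrow> 'm::comm_quantale) \<Rightarrow> 'm" where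
  "texp fv E \<Gamma> = (\<Prod>v\<in>fv E. \<Gamma> v)"

text \<open>The function is total on the quantale, although only arguments above \<open>1\<close> are
  meant.  In the loop case, \<open>lfp\<close> is taken over all environments; by \<open>alg_ge_one\<close> and
  \<open>alg_While_lfp\<close> below, this is the least fixed point among the environments above \<open>1\<close>.\<close>

primrec alg :: "('e \<Rightarrow> 'v::finite set) \<Rightarrow> ('v, 'e) com \<Rightarrow> 'm::comm_quantale
    \<Rightarrow> ('v \<Rightarrow> 'm) \<Rightarrow> ('v \<Rightarrow> 'm)" where
  "alg fv Skip p \<Gamma> = \<Gamma>"
| "alg fv (Assign x E) p \<Gamma> = \<Gamma>(x := p * texp fv E \<Gamma>)"
| "alg fv (Seq C1 C2) p \<Gamma> = alg fv C2 p (alg fv C1 p \<Gamma>)"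
| "alg fv (If E C1 C2) p \<Gamma> =
    (let t = texp fv E \<Gamma>;
         \<Gamma>1 = alg fv C1 (p * t) \<Gamma>;
         \<Gamma>2 = alg fv C2 (p * t) \<Gamma>
     in (\<lambda>x. if x \<in> asgn C1 \<union> asgn C2 then t * sup (\<Gamma>1 x) (\<Gamma>2 x) else \<Gamma> x))"
| "alg fv (While E C) p \<Gamma> =
    (let \<Gamma>s = lfp (\<lambda>\<Theta>. sup \<Gamma> (alg fv C (p * texp fv E \<Theta>) \<Theta>));
         t = texp fv E \<Gamma>s
     in (\<lambda>x. if x \<in> asgn C then qstar t * \<Gamma>s x else \<Gamma>s x))"

lemma texp_mono: "\<Gamma> \<le> \<Gamma>' \<Longrightarrow> texp fv E \<Gamma> \<le> texp fv E \<Gamma>'"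
  unfolding texp_def by (intro prod_mono_quantale) (auto simp: le_fun_def)

lemma texp_ge_one: "(\<And>x. 1 \<le> \<Gamma> x) \<Longrightarrow> 1 \<le> texp fv E \<Gamma>"
  unfolding texp_def by (rule one_le_prod_quantale)

lemma alg_mono: "p \<le> p' \<Longrightarrow> \<Gamma> \<le> \<Gamma>' \<Longrightarrow> alg fv C p \<Gamma> \<le> alg fv C p' \<Gamma>'"
proof (induction C arbitrary: p p' \<Gamma> \<Gamma>')
  case (Assign x E)
  then show ?case
    by (auto simp: le_fun_def intro!: mult_mono_quantale texp_mono[unfolded le_fun_def])
next
  case (If E C1 C2)
  have t: "texp fv E \<Gamma> \<le> texp fv E \<Gamma>'" by (rule texp_mono) (rule If)
  have pt: "p * texp fv E \<Gamma> \<le> p' * texp fv E \<Gamma>'" by (intro mult_mono_quantale t If)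
  show ?case
    using le_funD[OF If.IH(1)[OF pt If.prems(2)]] le_funD[OF If.IH(2)[OF pt If.prems(2)]]
      le_funD[OF If.prems(2)]
    by (auto simp: Let_def le_fun_def intro!: mult_mono_quantale t sup_mono)
next
  case (While E C)
  have s: "lfp (\<lambda>\<Theta>. sup \<Gamma> (alg fv C (p * texp fv E \<Theta>) \<Theta>))
      \<le> lfp (\<lambda>\<Theta>. sup \<Gamma>' (alg fv C (p' * texp fv E \<Theta>) \<Theta>))" (is "?s \<le> ?s'")
    by (intro lfp_mono sup_mono While mult_mono_quantale order_refl)
  show ?case
    using le_funD[OF s]
    by (auto simp: Let_def le_fun_def intro!: mult_mono_quantale qstar_mono texp_mono s)
qed simp_all

lemma alg_While_mono: "mono (\<lambda>\<Theta>. sup \<Gamma> (alg fv C (p * texp fv E \<Theta>) \<Theta>))"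
  by (intro monoI sup_mono order_refl alg_mono mult_mono_quantale texp_mono)

lemma alg_While_lfp:
  fixes fv :: "'e \<Rightarrow> 'v::finite set" and E :: 'e and C :: "('v, 'e) com"
    and p :: "'m::comm_quantale" and \<Gamma> :: "'v \<Rightarrow> 'm"
  assumes "\<And>x. 1 \<le> \<Gamma> x"
  defines "F \<equiv> \<lambda>\<Theta>. sup \<Gamma> (alg fv C (p * texp fv E \<Theta>) \<Theta>)"
  shows "F (lfp F) = lfp F" and "1 \<le> lfp F x" and "F \<Theta> = \<Theta> \<Longrightarrow> lfp F \<le> \<Theta>"
proof -
  show *: "F (lfp F) = lfp F"
    unfolding F_def by (rule lfp_unfold[OF alg_While_mono, symmetric])
  have "\<Gamma> \<le> lfp F" by (subst *[symmetric]) (simp add: F_def)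
  then show "1 \<le> lfp F x" using assms(1) by (metis le_funD order_trans)
  show "F \<Theta> = \<Theta> \<Longrightarrow> lfp F \<le> \<Theta>" by (rule lfp_lowerbound) simp
qed

lemma alg_ge_one: "1 \<le> p \<Longrightarrow> (\<And>x. 1 \<le> \<Gamma> x) \<Longrightarrow> 1 \<le> alg fv C p \<Gamma> x"
proof (induction C arbitrary: p \<Gamma> x)
  case (Seq C1 C2)
  then show ?case by simp
next
  case (If E C1 C2)
  then show ?case
    by (auto simp: Let_def intro!: one_le_mult_quantale texp_ge_one le_supI1 If.IH(1))
next
  case (While E C)
  then show ?case
    by (auto simp: Let_def intro!: one_le_mult_quantale one_le_qstar alg_While_lfp(2))
qed (auto intro: one_le_mult_quantale texp_ge_one)

definition Delta :: "('e \<Rightarrow> 'v::finite set) \<Rightarrow> ('v, 'e) com \<Rightarrow> 'v \<Rightarrow> 'v univ" where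
  "Delta fv C = alg fv C 1 gen"

definition DeltaN :: "('e \<Rightarrow> 'v::finite set) \<Rightarrow> ('v, 'e) com \<Rightarrow> 'v \<Rightarrow> 'v univN" where
  "DeltaN fv C = alg fv C 1 genN"

lemma one_le_gen: "1 \<le> gen v" and one_le_genN: "1 \<le> genN v"
  by (auto simp: less_eq_univ_def elems_one elems_gen down_def
      less_eq_univN_def elemsN_one elemsN_genN le_fun_def)

end

theory Submission
  imports Defs
begin

text \<open>
  Sending a multiplicity vector to its support induces a map from \<open>'v univN\<close> to \<open>'v univ\<close> that
  preserves joins, tensors and \<open>1\<close>, and takes generators to generators.  Such maps commute
  with the algorithmic system; for loops this is the fusion rule for least fixed points.  Hence
  the join over the support-level judgement runs over the supports of the vectors in the
  counting judgement, and idempotence of the variables with multiplicity at least two makes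
  the corresponding terms of both joins equal.
\<close>

locale quantale_hom =
  fixes h :: "'a::comm_quantale \<Rightarrow> 'b::comm_quantale"
  assumes hom_Sup: "h (Sup A) = Sup (h ` A)"
    and hom_one: "h 1 = 1"
    and hom_mult: "h (a * b) = h a * h b"
begin

lemma hom_sup: "h (sup a b) = sup (h a) (h b)"
  using hom_Sup[of "{a, b}"] by simp

lemma hom_prod: "h (prod f S) = (\<Prod>i\<in>S. h (f i))"
  by (induction S rule: infinite_finite_induct) (simp_all add: hom_one hom_mult)

lemma hom_power: "h (a ^ n) = h a ^ n"
  by (induction n) (simp_all add: hom_one hom_mult)

lemma hom_qstar: "h (qstar a) = qstar (h a)"
  by (simp add: qstar_def hom_Sup hom_power image_image)

lemma hom_texp: "h (texp fv E \<Gamma>) = texp fv E (\<lambda>v. h (\<Gamma> v))"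
  by (simp add: texp_def hom_prod)

text \<open>Fixed-point fusion. The property "\<open>h \<circ> \<Theta>\<close> lies below
  \<open>lfp G\<close>" survives a step of \<open>F\<close> by \<open>comm\<close>, and survives
  arbitrary joins, the empty one included, because \<open>h\<close> preserves them.\<close>

lemma hom_lfp:
  fixes F :: "('v \<Rightarrow> 'a) \<Rightarrow> ('v \<Rightarrow> 'a)" and G :: "('v \<Rightarrow> 'b) \<Rightarrow> ('v \<Rightarrow> 'b)"
  assumes F: "mono F" and G: "mono G" and comm: "\<And>\<Theta>. h \<circ> F \<Theta> = G (h \<circ> \<Theta>)"
  shows "h \<circ> lfp F = lfp G"
proof (rule antisym)
  show "h \<circ> lfp F \<le> lfp G"
  proof (rule lfp_ordinal_induct[OF F])
    fix \<Theta> assume "h \<circ> \<Theta> \<le> lfp G"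
    then show "h \<circ> F \<Theta> \<le> lfp G"
      unfolding comm by (subst lfp_unfold[OF G]) (rule monoD[OF G])
  next
    fix M assume "\<forall>\<Theta>\<in>M. h \<circ> \<Theta> \<le> lfp G"
    then show "h \<circ> Sup M \<le> lfp G"
      by (auto simp: le_fun_def hom_Sup image_image intro!: SUP_least)
  qed
  \<comment> \<open>By \<open>comm\<close>, \<open>h \<circ> lfp F\<close> is itself a fixed point
    of \<open>G\<close>.\<close>
  show "lfp G \<le> h \<circ> lfp F"
    by (rule lfp_lowerbound) (simp flip: comm lfp_unfold[OF F])
qed

text \<open>Every clause of \<open>alg\<close> is built from tensors, joins, \<open>qstar\<close>
  and \<open>lfp\<close>, all of which \<open>h\<close> respects; the case splits on
  \<open>asgn\<close> are purely syntactic.\<close>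

lemma hom_alg: "h \<circ> alg fv C p \<Gamma> = alg fv C (h p) (h \<circ> \<Gamma>)"
proof (induction C arbitrary: p \<Gamma>)
  case (Assign x E)
  show ?case by (rule ext) (simp add: hom_mult hom_texp comp_def)
next
  case (If E C1 C2)
  show ?case
    by (rule ext)
      (simp add: comp_def Let_def hom_mult hom_sup hom_texp fun_cong[OF If.IH(1), unfolded comp_def]
        fun_cong[OF If.IH(2), unfolded comp_def])
next
  case (While E C)
  let ?F = "\<lambda>\<Theta>. sup \<Gamma> (alg fv C (p * texp fv E \<Theta>) \<Theta>)"
  let ?G = "\<lambda>\<Theta>. sup (h \<circ> \<Gamma>) (alg fv C (h p * texp fv E \<Theta>) \<Theta>)"
  have "h \<circ> lfp ?F = lfp ?G"
  proof (rule hom_lfp[OF alg_While_mono alg_While_mono])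
    fix \<Theta>
    show "h \<circ> ?F \<Theta> = ?G (h \<circ> \<Theta>)"
      by (rule ext)
        (simp add: comp_def hom_sup hom_mult hom_texp fun_cong[OF While.IH, unfolded comp_def])
  qed
  then show ?case
    by (auto simp: comp_def Let_def hom_mult hom_qstar hom_texp fun_eq_iff)
qed simp_all

end

definition supp :: "('v \<Rightarrow> nat) \<Rightarrow> 'v set" where
  "supp m = {v. m v \<noteq> 0}"

definition collapse :: "'v univN \<Rightarrow> 'v univ" where
  "collapse D = Abs (supp ` elemsN D)"

lemma elems_collapse: "elems (collapse D) = supp ` elemsN D"
  unfolding collapse_def
proof (rule elems_Abs)
  fix X Y assume "X \<in> supp ` elemsN D" "Y \<subseteq> X"
  then obtain m where m: "m \<in> elemsN D" and Y: "Y \<subseteq> supp m" by blast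
  \<comment> \<open>Erasing the entries of \<open>m\<close> outside \<open>Y\<close> stays below
    \<open>m\<close> and leaves support exactly \<open>Y\<close>.\<close>
  let ?n = "\<lambda>v. if v \<in> Y then m v else 0"
  have "?n \<in> elemsN D" by (rule elemsN_downset[OF m]) (simp add: le_fun_def)
  moreover have "Y = supp ?n" using Y by (auto simp: supp_def)
  ultimately show "Y \<in> supp ` elemsN D" by blast
qed

text \<open>Natural numbers cannot cancel. This is what turns the tensor of \<open>univN\<close>
  into that of \<open>univ\<close>.\<close>

lemma supp_add: "supp (\<lambda>v. m v + n v) = supp m \<union> supp n"
  by (auto simp: supp_def)

interpretation collapse: quantale_hom collapse
proof
  fix A :: "'v univN set" and D E :: "'v univN"
  show "collapse (Sup A) = Sup (collapse ` A)"
    by (simp add: elems_inject[symmetric] elems_collapse elems_Sup elemsN_Sup image_UN)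
  show "collapse (1 :: 'v univN) = 1"
    by (simp add: elems_inject[symmetric] elems_collapse elems_one elemsN_one supp_def)
  have "supp ` {\<lambda>v. m v + n v | m n. m \<in> elemsN D \<and> n \<in> elemsN E} =
      {supp (\<lambda>v. m v + n v) | m n. m \<in> elemsN D \<and> n \<in> elemsN E}"
    by blast
  also have "\<dots> = {X \<union> Y | X Y. X \<in> supp ` elemsN D \<and> Y \<in> supp ` elemsN E}"
    unfolding supp_add by blast
  finally show "collapse (D * E) = collapse D * collapse E"
    unfolding elems_inject[symmetric] elems_collapse elems_times elemsN_times .
qed

lemma collapse_genN: "collapse (genN v) = gen v"
proof -
  have "supp ` down {\<lambda>u. if u = v then 1 else 0} = down {{v}}"
  proof (intro set_eqI iffI)
    fix X assume "X \<in> supp ` down {\<lambda>u. if u = v then 1 else 0}"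
    then obtain m where "X = supp m" "\<And>u. m u \<le> (if u = v then 1 else 0)"
      by (auto simp: down_def le_fun_def)
    then have "X \<subseteq> {v}" by (auto simp: supp_def split: if_splits) (metis le_zero_eq not_gr0)
    then show "X \<in> down {{v}}" by (simp add: down_def)
  next
    fix X assume "X \<in> down {{v}}"
    \<comment> \<open>The witness is the indicator vector of \<open>X\<close>.\<close>
    then have "X = supp (\<lambda>u. if u \<in> X then 1 else 0)" "X \<subseteq> {v}"
      by (auto simp: supp_def down_def)
    then show "X \<in> supp ` down {\<lambda>u. if u = v then 1 else 0}"
      by (auto simp: down_def le_fun_def intro!: image_eqI)
  qed
  then show ?thesis
    by (simp add: elems_inject[symmetric] elems_collapse elemsN_genN elems_gen)
qed

lemma collapse_DeltaN: "collapse (DeltaN fv C w) = Delta fv C w"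
proof -
  have gen: "collapse \<circ> genN = gen" by (auto simp: collapse_genN)
  have "collapse \<circ> DeltaN fv C = Delta fv C"
    unfolding DeltaN_def Delta_def collapse.hom_alg gen collapse.hom_one ..
  then show ?thesis by (metis comp_apply)
qed

lemma idem_power:
  fixes a :: "'a::monoid_mult"
  assumes "a * a = a" "n \<noteq> 0"
  shows "a ^ n = a"
  using assms(2)
proof (induction n)
  case (Suc n)
  then show ?case using assms(1) by (cases "n = 0") simp_all
qed simp

text \<open>Both joins can be indexed by the vectors of \<open>D\<close>, so it suffices to compare
  the terms for a single vector.\<close>

lemma alpha_collapse:
  assumes "\<And>v m. m \<in> elemsN D \<Longrightarrow> 2 \<le> m v \<Longrightarrow> \<sigma> v * \<sigma> v = \<sigma> v"
  shows "alpha \<sigma> (collapse D) = alphaN \<sigma> D"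
proof -
  have "(\<Prod>v\<in>supp m. \<sigma> v) = (\<Prod>v\<in>UNIV. \<sigma> v ^ m v)" if m: "m \<in> elemsN D" for m
  \<comment> \<open>Variables outside \<open>supp m\<close> contribute a zeroth power, hence 1;
    inside it, multiplicity 1 is immediate and a higher one needs idempotence.\<close>
  proof (rule prod.mono_neutral_cong_left)
    fix v assume "v \<in> supp m"
    then consider "m v = 1" | "2 \<le> m v" by (fastforce simp: supp_def)
    then show "\<sigma> v = \<sigma> v ^ m v"
      by cases (auto simp: idem_power[OF assms[OF m]])
  qed (auto simp: supp_def)
  then show ?thesis
    by (simp add: alpha_def alphaN_def elems_collapse image_image)
qed

theorem proposition6:
  fixes fv :: "'e \<Rightarrow> 'v::finite set"
    and C :: "('v, 'e) com"
    and W :: "'v set"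
    and \<sigma> :: "'v \<Rightarrow> 'm::comm_quantale"
  assumes "\<And>v. 1 \<le> \<sigma> v"
    and "\<And>v. (\<exists>m\<in>elemsN (\<Prod>w\<in>W. DeltaN fv C w). 2 \<le> m v) \<Longrightarrow> \<sigma> v * \<sigma> v = \<sigma> v"
  shows "alpha \<sigma> (\<Prod>w\<in>W. Delta fv C w) = alphaN \<sigma> (\<Prod>w\<in>W. DeltaN fv C w)"
proof -
  have "(\<Prod>w\<in>W. Delta fv C w) = collapse (\<Prod>w\<in>W. DeltaN fv C w)"
    by (simp add: collapse.hom_prod collapse_DeltaN)
  then show ?thesis using alpha_collapse assms(2) by metis
qed

end
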